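(* The following algorithm decides whether a connected strongly-proportional allocation exists for $n$ hungry agents with equal entitlements, using at most $n(n-1)$ queries: for $t=1,\dots,n-1$, compute $z_t=\textsc{Mark}_1(0,t/n)$ and, for $i=2,\dots,n$, if $\textsc{Mark}_i(0,t/n)\neq z_t$ return "true"; if no such discrepancy is found, return "false".
   Context: The cake is $C=[0,1]$, to be divided among agents $[n]$. Each agent $i$ has a valuation function $V_i$ on the algebra generated by intervals of $C$ that is non-negative, finitely additive, normalized ($V_i(C)=1$), with $x\mapsto V_i([0,x])$ continuous. Agent $i$ is hungry if $V_i(X)>0$ for every interval $X$ of positive length. Equal entitlements means each agent has entitlement $w_i=1/n$. An allocation is a partition $C=X_1\sqcup\cdots\sqcup X_n$ into finite unions of closed intervals, pairwise disjoint except possibly at endpoints; it is connected if each $X_i$ is a single interval and strongly-proportional if $V_i(X_i)>w_i$ for all $i$. Queries (each counts as one): $\textsc{Eval}_i(x,y)=V_i([x,y])$; $\textsc{Mark}_i(x,r)$ returns the largest $z\in C$ with $V_i([x,z])=r$, or $\infty$ if $V_i([x,1])<r$. *)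

theory Defs
  imports "HOL-Analysis.Analysis"
begin

abbreviation cake :: "real set" where
  "cake \<equiv> {0..1}"

definition cake_algebra :: "real set set" where
  "cake_algebra = \<Inter> {M. algebra cake M \<and> {I. is_interval I \<and> I \<subseteq> cake} \<subseteq> M}"

text \<open>The map \<open>x \<mapsto> V [0,x]\<close> is taken on the whole real line, with \<open>[0,x]\<close> empty for \<open>x < 0\<close>.
  Its continuity at \<open>0\<close> thus says \<open>V {0} = 0\<close>, i.e. no point of the cake is an atom
  (for points \<open>x > 0\<close> this follows from continuity on \<open>[0,1]\<close>). If \<open>V {0}\<close> could be
  positive, there would be no \<open>z\<close> with \<open>V [0,z] = r\<close> for \<open>0 < r < V {0}\<close>, and the
  Mark queries would be ill-defined.\<close>

definition valuation :: "(real set \<Rightarrow> real) \<Rightarrow> bool" where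
  "valuation V \<longleftrightarrow>
     (\<forall>A\<in>cake_algebra. 0 \<le> V A) \<and>
     (\<forall>A\<in>cake_algebra. \<forall>B\<in>cake_algebra. A \<inter> B = {} \<longrightarrow> V (A \<union> B) = V A + V B) \<and>
     V cake = 1 \<and>
     continuous_on UNIV (\<lambda>x. V ({0..x} \<inter> cake))"

definition hungry :: "(real set \<Rightarrow> real) \<Rightarrow> bool" where
  "hungry V \<longleftrightarrow> (\<forall>I. is_interval I \<and> I \<subseteq> cake \<and> measure lborel I > 0 \<longrightarrow> V I > 0)"

definition finite_union_of_closed_intervals :: "real set \<Rightarrow> bool" where
  "finite_union_of_closed_intervals X \<longleftrightarrow>
     (\<exists>\<I>. finite \<I> \<and> (\<forall>I\<in>\<I>. \<exists>a b. a \<le> b \<and> I = {a..b}) \<and> X = \<Union>\<I>)"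

text \<open>Agents are numbered \<open>1, \<dots>, n\<close>. The frontier of a finite union of closed intervals
  is the set of its endpoints (\<open>0\<close> and \<open>1\<close> included, as the frontier is taken in the real line).\<close>

definition allocation :: "nat \<Rightarrow> (nat \<Rightarrow> real set) \<Rightarrow> bool" where
  "allocation n X \<longleftrightarrow>
     (\<forall>i\<in>{1..n}. finite_union_of_closed_intervals (X i)) \<and>
     (\<Union>i\<in>{1..n}. X i) = cake \<and>
     (\<forall>i\<in>{1..n}. \<forall>j\<in>{1..n}. i \<noteq> j \<longrightarrow> X i \<inter> X j \<subseteq> frontier (X i) \<inter> frontier (X j))"

definition connected_allocation :: "nat \<Rightarrow> (nat \<Rightarrow> real set) \<Rightarrow> bool" where
  "connected_allocation n X \<longleftrightarrow> allocation n X \<and> (\<forall>i\<in>{1..n}. is_interval (X i))"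

definition strongly_proportional ::
  "nat \<Rightarrow> (nat \<Rightarrow> real set \<Rightarrow> real) \<Rightarrow> (nat \<Rightarrow> real) \<Rightarrow> (nat \<Rightarrow> real set) \<Rightarrow> bool" where
  "strongly_proportional n V w X \<longleftrightarrow> (\<forall>i\<in>{1..n}. V i (X i) > w i)"

definition equal_entitlements :: "nat \<Rightarrow> nat \<Rightarrow> real" where
  "equal_entitlements n i = 1 / real n"

datatype query = Eval nat real real | Mark nat real real

fun answer :: "(nat \<Rightarrow> real set \<Rightarrow> real) \<Rightarrow> query \<Rightarrow> ereal" where
  "answer V (Eval i x y) = ereal (V i {x..y})"
| "answer V (Mark i x r) =
     (if V i {x..1} < r then \<infinity> else ereal (GREATEST z. z \<in> cake \<and> V i {x..z} = r))"

text \<open>A protocol is a decision tree that has access to the valuations only through the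
  answers to its queries; \<open>query_count\<close> is the length of the branch that is followed.\<close>

datatype 'a protocol = Return 'a | Ask query "ereal \<Rightarrow> 'a protocol"

primrec result :: "(nat \<Rightarrow> real set \<Rightarrow> real) \<Rightarrow> 'a protocol \<Rightarrow> 'a" where
  "result V (Return b) = b"
| "result V (Ask q k) = result V (k (answer V q))"

primrec query_count :: "(nat \<Rightarrow> real set \<Rightarrow> real) \<Rightarrow> 'a protocol \<Rightarrow> nat" where
  "query_count V (Return b) = 0"
| "query_count V (Ask q k) = Suc (query_count V (k (answer V q)))"

text \<open>Inner loop over the agents \<open>i\<close> in the list; \<open>rest\<close> is what is executed when the
  loop ends without a discrepancy.\<close>

primrec compare_marks :: "real \<Rightarrow> ereal \<Rightarrow> bool protocol \<Rightarrow> nat list \<Rightarrow> bool protocol" where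
  "compare_marks r z rest [] = rest"
| "compare_marks r z rest (i # is) =
     Ask (Mark i 0 r) (\<lambda>z'. if z' \<noteq> z then Return True else compare_marks r z rest is)"

primrec scan_marks :: "nat \<Rightarrow> nat list \<Rightarrow> bool protocol" where
  "scan_marks n [] = Return False"
| "scan_marks n (t # ts) =
     Ask (Mark 1 0 (real t / real n))
       (\<lambda>z. compare_marks (real t / real n) z (scan_marks n ts) [2..<n + 1])"

definition existence_protocol :: "nat \<Rightarrow> bool protocol" where
  "existence_protocol n = scan_marks n [1..<n]"

end

theory Submission
  imports Defs
begin

text \<open>If the agents agree on all marks \<open>z\<^sub>t\<close>, a piece worth more than \<open>1/n\<close> to its owner has some
  \<open>z\<^sub>t\<close> with \<open>1 \<le> t \<le> n - 1\<close> in its interior, and \<open>n\<close> pieces with disjoint interiors cannot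
  do that with only \<open>n - 1\<close> marks. If they disagree on the \<open>t\<close>-th mark, cut the cake at the \<open>t\<close>-th
  smallest of these marks, and let the \<open>t\<close> agents with the smallest marks share the left part and
  the others share the right part, both by the last-diminisher procedure. Everyone gets at least
  \<open>1/n\<close>, and an agent whose mark differs from the cut gets strictly more; her surplus can be
  passed on to her neighbours, one after the other, by moving the cut points slightly.\<close>

section \<open>Valuations and their distribution functions\<close>

lemma interval_in_cake_algebra:
  assumes "is_interval I" "I \<subseteq> cake"
  shows "I \<in> cake_algebra"
  using assms by (auto simp: cake_algebra_def)

text \<open>The last two summands make the function strictly increasing on the whole line, so that cut
  points need not be confined to the cake.\<close>

definition cdf :: "(real set \<Rightarrow> real) \<Rightarrow> real \<Rightarrow> real" where
  "cdf V x = V ({0..x} \<inter> cake) + min x 0 + max (x - 1) 0"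

context
  fixes V :: "real set \<Rightarrow> real"
  assumes val: "valuation V"
begin

lemma valuation_nonneg:
  assumes "is_interval I" "I \<subseteq> cake"
  shows "0 \<le> V I"
  using val interval_in_cake_algebra[OF assms] by (auto simp: valuation_def)

lemma valuation_Un:
  assumes "is_interval I" "I \<subseteq> cake" "is_interval J" "J \<subseteq> cake" "I \<inter> J = {}"
  shows "V (I \<union> J) = V I + V J"
  using val interval_in_cake_algebra[OF assms(1,2)] interval_in_cake_algebra[OF assms(3,4)] assms(5)
  by (auto simp: valuation_def)

lemma valuation_empty: "V {} = 0"
  using valuation_Un[of "{}" "{}"] by simp

lemma valuation_cake: "V cake = 1"
  using val by (simp add: valuation_def)

lemma continuous_on_cdf: "continuous_on UNIV (cdf V)"
  using val unfolding valuation_def cdf_def by (intro continuous_intros) auto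

text \<open>For \<open>y < x\<close> the point \<open>x\<close> contributes at least
  \<open>V {x}\<close> to the increase of the distribution function from \<open>y\<close> to
  \<open>x\<close>, and left continuity makes this increase vanish as \<open>y\<close> tends to
  \<open>x\<close>. The case \<open>x = 0\<close> is covered because continuity is assumed on the
  whole line.\<close>

lemma valuation_singleton:
  assumes "x \<in> cake"
  shows "V {x} = 0"
proof -
  let ?F = "\<lambda>x. V ({0..x} \<inter> cake)"
  have below: "V {x} \<le> ?F x - ?F y" if "y < x" for y
  proof -
    have "{0..x} \<inter> cake = ({0..y} \<inter> cake) \<union> (({y<..<x} \<inter> cake) \<union> {x})"
      "{y<..x} \<inter> cake = ({y<..<x} \<inter> cake) \<union> {x}"
      using that assms by auto
    moreover have "V (({0..y} \<inter> cake) \<union> ({y<..x} \<inter> cake)) = ?F y + V ({y<..x} \<inter> cake)"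
      by (rule valuation_Un) (auto simp: is_interval_1)
    moreover have "V (({y<..<x} \<inter> cake) \<union> {x}) = V ({y<..<x} \<inter> cake) + V {x}"
      using assms by (intro valuation_Un) (auto simp: is_interval_1)
    moreover have "0 \<le> V ({y<..<x} \<inter> cake)"
      by (rule valuation_nonneg) (auto simp: is_interval_1)
    ultimately show ?thesis by simp
  qed
  have "continuous_on UNIV ?F"
    using val by (simp add: valuation_def)
  then have "isCont ?F x"
    by (simp add: continuous_on_eq_continuous_at)
  then have "(?F \<longlongrightarrow> ?F x) (at_left x)"
    using continuous_at_imp_continuous_at_within[of x ?F "{..<x}"] by (simp only: continuous_within)
  then have "((\<lambda>y. ?F x - ?F y) \<longlongrightarrow> ?F x - ?F x) (at_left x)"
    by (intro tendsto_intros)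
  moreover have "eventually (\<lambda>y. V {x} \<le> ?F x - ?F y) (at_left x)"
    using below by (auto simp: eventually_at_filter)
  ultimately have "V {x} \<le> ?F x - ?F x"
    by (intro tendsto_lowerbound) auto
  moreover have "0 \<le> V {x}"
    using assms by (intro valuation_nonneg) (auto simp: is_interval_1)
  ultimately show ?thesis by simp
qed

lemma cdf_cake: "x \<in> cake \<Longrightarrow> cdf V x = V {0..x}"
  by (simp add: cdf_def)

lemma cdf_nonpos: "x \<le> 0 \<Longrightarrow> cdf V x = x"
  using valuation_empty valuation_singleton[of 0] by (cases "x = 0") (auto simp: cdf_def)

lemma cdf_ge_1: "1 \<le> x \<Longrightarrow> cdf V x = x"
  using valuation_cake by (simp add: cdf_def)

text \<open>Additivity is available for disjoint sets only, so \<open>{0..y}\<close> is cut at the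
  half-open \<open>{0..<x}\<close>; the point \<open>x\<close> thus left out has value 0.\<close>

lemma valuation_atLeastAtMost:
  assumes "0 \<le> x" "x \<le> y" "y \<le> 1"
  shows "V {x..y} = cdf V y - cdf V x"
proof -
  have "V ({0..<x} \<union> {x..y}) = V {0..<x} + V {x..y}"
    using assms by (intro valuation_Un) (auto simp: is_interval_1)
  moreover have "V ({0..<x} \<union> {x}) = V {0..<x} + V {x}"
    using assms by (intro valuation_Un) (auto simp: is_interval_1)
  moreover have "{0..<x} \<union> {x..y} = {0..y}" "{0..<x} \<union> {x} = {0..x}"
    using assms by auto
  ultimately show ?thesis
    using assms valuation_singleton[of x] by (simp add: cdf_cake)
qed

text \<open>Hunger gives the increase inside the cake, slope 1 gives it outside, and the mixed cases
  are compared through the values at 0 and 1.\<close>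

lemma strict_mono_cdf:
  assumes "hungry V"
  shows "strict_mono (cdf V)"
proof (rule strict_monoI)
  have inner: "cdf V x < cdf V y" if "0 \<le> x" "x < y" "y \<le> 1" for x y
  proof -
    have "V {x..y} > 0"
      using assms that by (auto simp: hungry_def is_interval_cc)
    then show ?thesis
      using valuation_atLeastAtMost[of x y] that by simp
  qed
  have inner_le: "cdf V x \<le> cdf V y" if "0 \<le> x" "x \<le> y" "y \<le> 1" for x y
    using inner[of x y] that by (cases "x = y") auto
  have ends: "cdf V 0 = 0" "cdf V 1 = 1"
    by (simp_all add: cdf_nonpos cdf_ge_1)
  fix x y :: real
  assume "x < y"
  consider "y \<le> 0" | "1 \<le> x" | "x \<le> 0" "1 \<le> y" | "x < 0" "0 < y" "y < 1"
    | "0 < x" "x < 1" "1 < y" | "0 \<le> x" "y \<le> 1"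
    using \<open>x < y\<close> by linarith
  then show "cdf V x < cdf V y"
  proof cases
    case 4
    then show ?thesis using inner_le[of 0 y] ends cdf_nonpos[of x] by simp
  next
    case 5
    then show ?thesis using inner_le[of x 1] ends cdf_ge_1[of y] by simp
  qed (use \<open>x < y\<close> in \<open>auto simp: cdf_nonpos cdf_ge_1 inner\<close>)
qed

end

section \<open>Marks and the protocol\<close>

text \<open>The intermediate value theorem provides a mark, and strict monotonicity makes it the
  only one, so that \<open>GREATEST\<close> ranges over a singleton. The answer is finite since the
  whole cake is worth \<open>1 > r\<close>.\<close>

lemma answer_Mark_0:
  assumes "valuation (V i)" "hungry (V i)" "0 < r" "r < 1"
  shows "\<exists>m. cdf (V i) m = r \<and> answer V (Mark i 0 r) = ereal m"
proof -
  let ?F = "cdf (V i)"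
  note val = \<open>valuation (V i)\<close>
  have sm: "strict_mono ?F"
    using strict_mono_cdf[OF val] assms by simp
  have ends: "?F 0 = 0" "?F 1 = 1"
    by (simp_all add: cdf_nonpos[OF val] cdf_ge_1[OF val])
  obtain m where m: "0 \<le> m" "m \<le> 1" "?F m = r"
    using IVT'[of ?F 0 r 1] ends assms continuous_on_subset[OF continuous_on_cdf[OF val]] by auto
  have "z \<in> cake \<and> V i {0..z} = r \<longleftrightarrow> z = m" for z
    using m strict_mono_eq[OF sm, of z m] by (auto simp: cdf_cake[OF val])
  then have "(GREATEST z. z \<in> cake \<and> V i {0..z} = r) = m"
    by (simp add: Greatest_equality)
  then show ?thesis
    using m valuation_cake[OF val] assms by auto
qed

lemma result_compare_marks:
  "result V (compare_marks r z rest is) \<longleftrightarrow>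
     (\<exists>i\<in>set is. answer V (Mark i 0 r) \<noteq> z) \<or> result V rest"
  by (induction "is") (auto simp del: answer.simps)

lemma result_scan_marks:
  "result V (scan_marks n ts) \<longleftrightarrow>
     (\<exists>t\<in>set ts. \<exists>i\<in>{2..n}.
        answer V (Mark i 0 (real t / n)) \<noteq> answer V (Mark 1 0 (real t / n)))"
  by (induction ts) (auto simp: result_compare_marks simp del: answer.simps)

lemma query_count_compare_marks:
  "query_count V (compare_marks r z rest is) \<le> length is + query_count V rest"
  by (induction "is") (auto simp del: answer.simps)

lemma query_count_scan_marks:
  assumes "n \<ge> 1"
  shows "query_count V (scan_marks n ts) \<le> n * length ts"
proof (induction ts)
  case (Cons t ts)
  let ?r = "real t / real n"
  \<comment> \<open>One query to agent 1, then at most \<open>n - 1\<close> comparisons, the length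
    of \<open>[2..<n + 1]\<close>; a discrepancy only shortens the branch.\<close>
  have "query_count V (scan_marks n (t # ts)) \<le> Suc (n - 1 + query_count V (scan_marks n ts))"
    using query_count_compare_marks[of V ?r "answer V (Mark 1 0 ?r)" "scan_marks n ts" "[2..<n + 1]"]
    by (simp del: answer.simps upt_Suc)
  then show ?case using Cons assms by simp
qed simp

section \<open>Cutting an interval along a list of agents\<close>

text \<open>The list gives the agents in the order of their pieces from left to right. Cut points
  stay existential, so that they can be moved by induction on the list.\<close>

primrec splits :: "('a \<Rightarrow> real \<Rightarrow> real \<Rightarrow> bool) \<Rightarrow> 'a list \<Rightarrow> real \<Rightarrow> real \<Rightarrow> bool" where
  "splits Q [] a b \<longleftrightarrow> a = b"
| "splits Q (i # is) a b \<longleftrightarrow> (\<exists>c. Q i a c \<and> splits Q is c b)"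

lemma splits_append: "splits Q (is @ js) a b \<longleftrightarrow> (\<exists>c. splits Q is a c \<and> splits Q js c b)"
  by (induction "is" arbitrary: a) auto

lemma splits_mono:
  assumes "splits Q is a b" "\<And>i x y. i \<in> set is \<Longrightarrow> Q i x y \<Longrightarrow> Q' i x y"
  shows "splits Q' is a b"
  using assms by (induction "is" arbitrary: a) (auto, blast)

text \<open>Turns the existential cut points into endpoint functions, from which an allocation can
  be built. Distinctness lets \<open>L\<close> and \<open>R\<close> be updated at the first agent
  without affecting the others. The empty list is excepted from the covering claim: its union is
  empty, but \<open>{a..b}\<close> is then a point.\<close>

lemma splits_pieces:
  assumes "splits Q is a b" "distinct is" "\<And>i x y. Q i x y \<Longrightarrow> x < y"
  shows "\<exists>L R. (\<forall>i\<in>set is. a \<le> L i \<and> R i \<le> b \<and> Q i (L i) (R i)) \<and>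
    (is \<noteq> [] \<longrightarrow> (\<Union>i\<in>set is. {L i..R i}) = {a..b}) \<and>
    (\<forall>i\<in>set is. \<forall>j\<in>set is. i \<noteq> j \<longrightarrow> R i \<le> L j \<or> R j \<le> L i) \<and> a \<le> b"
  using assms(1,2)
proof (induction "is" arbitrary: a)
  case (Cons k ks)
  then obtain c where c: "Q k a c" "splits Q ks c b" by auto
  from Cons.IH[OF c(2)] Cons.prems(2) obtain L R where LR:
    "\<forall>i\<in>set ks. c \<le> L i \<and> R i \<le> b \<and> Q i (L i) (R i)"
    "ks \<noteq> [] \<longrightarrow> (\<Union>i\<in>set ks. {L i..R i}) = {c..b}"
    "\<forall>i\<in>set ks. \<forall>j\<in>set ks. i \<noteq> j \<longrightarrow> R i \<le> L j \<or> R j \<le> L i" "c \<le> b"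
    by auto
  have "a < c" using c assms(3) by blast
  have k: "k \<notin> set ks" using Cons.prems by simp
  define L' R' where "L' = L(k := a)" and "R' = R(k := c)"
  have same: "L' i = L i" "R' i = R i" if "i \<in> set ks" for i
    using that k by (auto simp: L'_def R'_def)
  have at_k: "L' k = a" "R' k = c" by (simp_all add: L'_def R'_def)
  have "(\<Union>i\<in>set ks. {L' i..R' i}) = (\<Union>i\<in>set ks. {L i..R i})"
    using same by simp
  then have "(\<Union>i\<in>set (k # ks). {L' i..R' i}) = {a..b}"
    using LR(2,4) c(2) \<open>a < c\<close> at_k by (cases "ks = []") auto
  moreover have "\<forall>i\<in>set (k # ks). a \<le> L' i \<and> R' i \<le> b \<and> Q i (L' i) (R' i)"
    using LR(1,4) c(1) \<open>a < c\<close> same at_k by force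
  moreover have "\<forall>i\<in>set (k # ks). \<forall>j\<in>set (k # ks). i \<noteq> j \<longrightarrow> R' i \<le> L' j \<or> R' j \<le> L' i"
    using LR(1,3) same at_k by auto
  ultimately show ?case
    using LR(4) \<open>a < c\<close> by (intro exI[of _ L'] exI[of _ R']) auto
qed auto

section \<open>Division of an interval under strictly increasing continuous value functions\<close>

context
  fixes F :: "'a \<Rightarrow> real \<Rightarrow> real" and S :: "'a set"
  assumes sm: "\<And>i. i \<in> S \<Longrightarrow> strict_mono (F i)"
    and cont: "\<And>i. i \<in> S \<Longrightarrow> continuous_on UNIV (F i)"
begin

lemma isCont_F: "i \<in> S \<Longrightarrow> isCont (F i) x"
  using cont by (simp add: continuous_on_eq_continuous_at)

text \<open>By continuity a strict inequality survives a small move of the cut point; this is how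
  part of a surplus is turned into length.\<close>

lemma exists_greater:
  assumes "i \<in> S" "F i a < v"
  shows "\<exists>a'>a. F i a' < v"
proof -
  have "eventually (\<lambda>x. F i x < v) (at_right a)"
    using isCont_F[OF assms(1), of a] assms(2)
    by (auto intro!: order_tendstoD(2) simp: continuous_within[symmetric]
        continuous_at_imp_continuous_at_within)
  then have "eventually (\<lambda>x. F i x < v \<and> a < x) (at_right a)"
    by (auto intro: eventually_conj eventually_at_right_less)
  then show ?thesis
    using eventually_happens'[OF trivial_limit_at_right_real] by blast
qed

lemma exists_less:
  assumes "i \<in> S" "v < F i a"
  shows "\<exists>a'<a. v < F i a'"
proof -
  have "eventually (\<lambda>x. v < F i x) (at_left a)"
    using isCont_F[OF assms(1), of a] assms(2)
    by (auto intro!: order_tendstoD(1) simp: continuous_within[symmetric]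
        continuous_at_imp_continuous_at_within)
  then have "eventually (\<lambda>x. v < F i x \<and> x < a) (at_left a)"
    by (auto intro: eventually_conj simp: eventually_at_filter)
  then show ?thesis
    using eventually_happens'[OF trivial_limit_at_left_real] by blast
qed

text \<open>The agent whose first acceptable cut is leftmost takes the piece up to it. To any other
  agent \<open>i\<close> this piece is worth at most \<open>v i\<close>, so the rest still suffices
  for those who remain. The thresholds may differ between agents.\<close>

lemma last_diminisher:
  assumes "finite A" "A \<noteq> {}" "A \<subseteq> S"
    and "\<And>i. i \<in> A \<Longrightarrow> 0 < v i"
    and "\<And>i. i \<in> A \<Longrightarrow> real (card A) * v i \<le> F i b - F i a"
  shows "\<exists>is. distinct is \<and> set is = A \<and> splits (\<lambda>i x y. v i \<le> F i y - F i x) is a b"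
  using assms
proof (induction "card A" arbitrary: A a)
  case (Suc k)
  \<comment> \<open>\<open>c i\<close> will be the point at which the piece starting at
    \<open>a\<close> is worth exactly \<open>v i\<close> to agent \<open>i\<close>.\<close>
  have "\<exists>c. F i c = F i a + v i" if "i \<in> A" for i
  proof -
    have "1 * v i \<le> real (card A) * v i"
      using Suc.hyps(2) Suc.prems(4)[OF that] by (intro mult_right_mono) auto
    then have le: "F i a + v i \<le> F i b"
      using Suc.prems(5)[OF that] by simp
    then have "a \<le> b"
      using sm[of i] Suc.prems(3,4) that strict_mono_less_eq[of "F i" a b] by fastforce
    then show ?thesis
      using IVT'[of "F i" a "F i a + v i" b] le Suc.prems(3,4) that
        continuous_on_subset[OF cont[of i]] by force
  qed
  then obtain c where c: "\<And>i. i \<in> A \<Longrightarrow> F i (c i) = F i a + v i"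
    by metis
  obtain k0 where k0: "k0 \<in> A" "\<And>i. i \<in> A \<Longrightarrow> c k0 \<le> c i"
    using Suc.prems(1,2) by (metis arg_min_if_finite(1) arg_min_least)
  show ?case
  proof (cases "A = {k0}")
    \<comment> \<open>The last agent takes all that is left, so that the pieces end exactly at
      \<open>b\<close>.\<close>
    case True
    then show ?thesis
      using Suc.prems(5)[of k0] by (intro exI[of _ "[k0]"]) auto
  next
    case False
    have rest: "real (card (A - {k0})) * v i \<le> F i b - F i (c k0)" if i: "i \<in> A - {k0}" for i
    proof -
      have "F i (c k0) \<le> F i (c i)"
        using sm[of i] k0(2)[of i] i Suc.prems(3) by (auto simp: strict_mono_less_eq)
      then have "F i (c k0) \<le> F i a + v i"
        using c i by auto
      moreover have "real (card A) * v i \<le> F i b - F i a"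
        using Suc.prems(5) i by auto
      moreover have "real (card A) * v i = real (card (A - {k0})) * v i + v i"
        using k0(1) Suc.prems(1) Suc.hyps(2) by (simp add: algebra_simps flip: Suc.hyps(2))
      ultimately show ?thesis by linarith
    qed
    have "k = card (A - {k0})" using Suc.hyps(2) k0(1) by simp
    then obtain js where js: "distinct js" "set js = A - {k0}"
      "splits (\<lambda>i x y. v i \<le> F i y - F i x) js (c k0) b"
      using Suc.hyps(1)[of "A - {k0}" "c k0"] Suc.prems(1,3,4) False k0(1) rest by blast
    then show ?thesis
      using c[OF k0(1)] k0(1) by (intro exI[of _ "k0 # js"]) auto
  qed
qed simp

text \<open>The additional length beyond \<open>b\<close> travels leftwards: each agent gains
  strictly at her right end and gives up a part of the gain at her left end. For the empty list,
  \<open>a'\<close> is \<open>b'\<close>.\<close>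

lemma push_right:
  assumes "splits (\<lambda>i x y. w \<le> F i y - F i x) is a b" "set is \<subseteq> S" "b < b'"
  shows "\<exists>a'>a. splits (\<lambda>i x y. w < F i y - F i x) is a' b'"
  using assms
proof (induction "is" arbitrary: a)
  case (Cons k ks)
  then obtain c where c: "w \<le> F k c - F k a" "splits (\<lambda>i x y. w \<le> F i y - F i x) ks c b"
    by auto
  then obtain c' where c': "c' > c" "splits (\<lambda>i x y. w < F i y - F i x) ks c' b'"
    using Cons.IH Cons.prems by auto
  have "F k c < F k c'"
    using sm[of k] c'(1) Cons.prems(2) by (auto simp: strict_mono_less)
  then have "F k a < F k c' - w" using c(1) by linarith
  then obtain a' where "a' > a" "F k a' < F k c' - w"
    using exists_greater[of k a] Cons.prems(2) by (meson list.set_intros(1) subsetD)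
  then show ?case using c'(2) by (intro exI[of _ a']) (auto intro!: exI[of _ c'])
qed auto

text \<open>Mirror image of \<open>push_right\<close>. The additional length now enters at the head
  of the list, so the induction has to generalize over \<open>a'\<close> too.\<close>

lemma push_left:
  assumes "splits (\<lambda>i x y. w \<le> F i y - F i x) is a b" "set is \<subseteq> S" "a' < a"
  shows "\<exists>b'<b. splits (\<lambda>i x y. w < F i y - F i x) is a' b'"
  using assms
proof (induction "is" arbitrary: a a')
  case (Cons k ks)
  then obtain c where c: "w \<le> F k c - F k a" "splits (\<lambda>i x y. w \<le> F i y - F i x) ks c b"
    by auto
  have "F k a' < F k a"
    using sm[of k] Cons.prems(2,3) by (auto simp: strict_mono_less)
  then have "F k a' + w < F k c" using c(1) by linarith
  then obtain c' where c': "c' < c" "F k a' + w < F k c'"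
    using exists_less[of k _ c] Cons.prems(2) by (meson list.set_intros(1) subsetD)
  then obtain b' where "b' < b" "splits (\<lambda>i x y. w < F i y - F i x) ks c' b'"
    using Cons.IH[OF c(2) _ c'(1)] Cons.prems(2) by auto
  then show ?case using c'(2) by (intro exI[of _ b']) (auto intro!: exI[of _ c'])
qed auto

text \<open>The two outermost pieces absorb the added cake. This needs an agent, since the empty
  list forces equal ends.\<close>

lemma splits_widen:
  assumes "splits (\<lambda>i x y. w < F i y - F i x) is a b" "is \<noteq> []" "set is \<subseteq> S"
    and "a' \<le> a" "b \<le> b'"
  shows "splits (\<lambda>i x y. w < F i y - F i x) is a' b'"
  using assms
proof (induction "is" arbitrary: a a')
  case (Cons k ks)
  then obtain c where c: "w < F k c - F k a" "splits (\<lambda>i x y. w < F i y - F i x) ks c b"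
    by auto
  have mono: "F k x \<le> F k y" if "x \<le> y" for x y
    using sm[of k] Cons.prems(3) that by (auto simp: strict_mono_less_eq)
  show ?case
  proof (cases "ks = []")
    case True
    then show ?thesis
      using c mono[OF Cons.prems(4)] mono[OF Cons.prems(5)] by auto
  next
    case False
    \<comment> \<open>Only the first agent extends to the left, so the tail keeps its left end
      \<open>c\<close>.\<close>
    then have "splits (\<lambda>i x y. w < F i y - F i x) ks c b'"
      using Cons.IH[OF c(2), of c] Cons.prems by auto
    then show ?thesis
      using c(1) mono[OF Cons.prems(4)] by (auto intro!: exI[of _ c])
  qed
qed simp

text \<open>Agent \<open>s\<close> retreats to \<open>{c'..d'}\<close>, still above
  \<open>w\<close>. The agents on her left are pushed right and those on her right are pushed left,
  all of them now strictly above \<open>w\<close>. The gaps this opens at \<open>a\<close> and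
  \<open>b\<close> are filled by widening.\<close>

lemma share_surplus:
  assumes "splits (\<lambda>i x y. v i \<le> F i y - F i x) is a b" "set is \<subseteq> S"
    and "\<And>i. i \<in> set is \<Longrightarrow> w \<le> v i" "s \<in> set is" "w < v s"
  shows "splits (\<lambda>i x y. w < F i y - F i x) is a b"
proof -
  let ?P = "splits (\<lambda>i x y. w \<le> F i y - F i x)" and ?S = "splits (\<lambda>i x y. w < F i y - F i x)"
  obtain js ks where isq: "is = js @ s # ks"
    using split_list[OF assms(4)] by blast
  have s: "s \<in> S" and sub: "set js \<subseteq> S" "set ks \<subseteq> S" using assms(2) isq by auto
  obtain c d where "splits (\<lambda>i x y. v i \<le> F i y - F i x) js a c" and cd: "v s \<le> F s d - F s c"
    and "splits (\<lambda>i x y. v i \<le> F i y - F i x) ks d b"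
    using assms(1) isq by (auto simp: splits_append)
  then have js: "?P js a c" and ks: "?P ks d b"
    using assms(3) isq by (auto elim!: splits_mono intro: order_trans)
  have "F s c < F s d - w" using cd assms(5) by linarith
  then obtain c' where c': "c' > c" "F s c' < F s d - w"
    using exists_greater[OF s] by blast
  then have "F s c' + w < F s d" by linarith
  then obtain d' where d': "d' < d" "F s c' + w < F s d'"
    using exists_less[OF s] by blast
  obtain a' where a': "a' > a" "?S js a' c'" using push_right[OF js sub(1) c'(1)] by blast
  obtain b' where b': "b' < b" "?S ks d' b'" using push_left[OF ks sub(2) d'(1)] by blast
  have "?S (js @ s # ks) a' b'"
    unfolding splits_append using a'(2) b'(2) d'(2)
    by (intro exI[of _ c']) (auto intro!: exI[of _ d'])
  then show ?thesis
    using splits_widen[of w "is" a' b' a b] a'(1) b'(1) assms(2) isq by auto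
qed

end

text \<open>Selects the \<open>t\<close> agents with the smallest marks, ties being broken
  arbitrarily; the induction adds a minimizer among the remaining ones.\<close>

lemma exists_smallest_subset:
  fixes m :: "'a \<Rightarrow> real"
  assumes "finite S" "t \<le> card S"
  shows "\<exists>A\<subseteq>S. card A = t \<and> (\<forall>i\<in>A. \<forall>j\<in>S - A. m i \<le> m j)"
  using assms(2)
proof (induction t)
  case 0
  then show ?case by (intro exI[of _ "{}"]) auto
next
  case (Suc t)
  then obtain A where A: "A \<subseteq> S" "card A = t" "\<forall>i\<in>A. \<forall>j\<in>S - A. m i \<le> m j" by auto
  then have ne: "S - A \<noteq> {}" using Suc.prems by auto
  obtain k where k: "k \<in> S - A" "\<And>j. j \<in> S - A \<Longrightarrow> m k \<le> m j"
    using ne assms(1) by (metis arg_min_if_finite(1) arg_min_least finite_Diff)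
  have "finite A" using A(1) assms(1) by (rule finite_subset)
  then show ?case using A k by (intro exI[of _ "insert k A"]) auto
qed

section \<open>The two directions\<close>

lemma strongly_proportional_if_marks_differ:
  fixes n t :: nat and V :: "nat \<Rightarrow> real set \<Rightarrow> real"
  assumes val: "\<And>i. i \<in> {1..n} \<Longrightarrow> valuation (V i)"
    and hun: "\<And>i. i \<in> {1..n} \<Longrightarrow> hungry (V i)"
    and t: "1 \<le> t" "t < n"
    and m: "\<And>i. i \<in> {1..n} \<Longrightarrow> cdf (V i) (m i) = t / n"
    and differ: "p \<in> {1..n}" "q \<in> {1..n}" "m p \<noteq> m q"
  shows "\<exists>X. connected_allocation n X \<and> strongly_proportional n V (equal_entitlements n) X"
proof -
  define F where "F i = cdf (V i)" for i
  have sm: "strict_mono (F i)" and cont: "continuous_on UNIV (F i)"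
    and ends: "F i 0 = 0" "F i 1 = 1" if "i \<in> {1..n}" for i
    using strict_mono_cdf[OF val hun] continuous_on_cdf[OF val] cdf_nonpos[OF val] cdf_ge_1[OF val]
      that by (auto simp: F_def)
  obtain A where A: "A \<subseteq> {1..n}" "card A = t" "\<forall>i\<in>A. \<forall>j\<in>{1..n} - A. m i \<le> m j"
    using exists_smallest_subset[of "{1..n}" t m] t by auto
  have finA: "finite A" using A(1) finite_subset by blast
  have neA: "A \<noteq> {}" using A(2) t by auto
  define B where "B = {1..n} - A"
  have B: "B \<subseteq> {1..n}" "finite B" "card B = n - t" "B \<noteq> {}"
    using A t finA by (auto simp: B_def card_Diff_subset)
  have card_B: "real (card B) = real n - real t" using B(3) t by simp
  \<comment> \<open>The \<open>t\<close>-th smallest mark. Agents in \<open>A\<close> value the part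
    left of it at \<open>t / n\<close> or more, and those in \<open>B\<close> value the part right
    of it at \<open>1 - t / n\<close> or more.\<close>
  define x where "x = Max (m ` A)"
  have xA: "m i \<le> x" if "i \<in> A" for i using that finA by (simp add: x_def)
  have xB: "x \<le> m j" if "j \<in> B" for j
    using that A(3) finA neA by (simp add: x_def B_def)
  have Fx_le: "F i x \<le> t / n" if "i \<in> {1..n}" "x \<le> m i" for i
    using that sm[OF that(1)] m[OF that(1)] by (auto simp: F_def strict_mono_less_eq dest: sym)
  have FA: "t / n \<le> F i x" if "i \<in> A" for i
    using that sm[of i] m[of i] xA[of i] A(1) by (auto simp: F_def strict_mono_less_eq subset_iff dest: sym)
  have FB: "F i x \<le> t / n" if "i \<in> B" for i
    using Fx_le xB that B(1) by blast
  \<comment> \<open>The share of agent \<open>i\<close> if her side were divided equally by her own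
    measure, with \<open>t\<close> agents on the left and \<open>n - t\<close> on the right. It
    equals \<open>1 / n\<close> only if her mark is \<open>x\<close>.\<close>
  define v where "v i = (if i \<in> A then F i x / t else (1 - F i x) / (real n - real t))" for i
  have vge: "1 / n \<le> v i" if "i \<in> {1..n}" for i
  proof (cases "i \<in> A")
    case True
    then show ?thesis using FA[OF True] t by (simp add: v_def field_simps)
  next
    case False
    then have "F i x \<le> t / n" using FB that by (simp add: B_def)
    then show ?thesis using False t by (simp add: v_def field_simps)
  qed
  have vpos: "0 < v i" if "i \<in> {1..n}" for i
    by (rule less_le_trans[OF _ vge[OF that]]) (use t in simp)
  \<comment> \<open>As \<open>m p\<close> and \<open>m q\<close> differ, at least one of them is not
    \<open>x\<close>; that agent has the surplus.\<close>
  obtain s where s: "s \<in> {1..n}" "m s \<noteq> x" using differ by metis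
  have "F s x \<noteq> t / n"
    using m[OF s(1)] s strict_mono_eq[OF sm[OF s(1)], of "m s" x] by (simp add: F_def)
  have "v s \<noteq> 1 / n"
  proof (cases "s \<in> A")
    case True
    then show ?thesis using \<open>F s x \<noteq> t / n\<close> t by (simp add: v_def field_simps)
  next
    case False
    then show ?thesis using \<open>F s x \<noteq> t / n\<close> t by (auto simp: v_def field_simps)
  qed
  then have vs: "1 / n < v s" using vge[OF s(1)] by simp
  have "\<exists>is. distinct is \<and> set is = A \<and> splits (\<lambda>i x y. v i \<le> F i y - F i x) is 0 x"
  proof (rule last_diminisher[of "{1..n}"])
    show "real (card A) * v i \<le> F i x - F i 0" if "i \<in> A" for i
      using that A t ends(1)[of i] by (auto simp: v_def)
  qed (use sm cont finA neA A(1) vpos in auto)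
  then obtain js where js: "distinct js" "set js = A"
    "splits (\<lambda>i x y. v i \<le> F i y - F i x) js 0 x" by blast
  have "\<exists>is. distinct is \<and> set is = B \<and> splits (\<lambda>i x y. v i \<le> F i y - F i x) is x 1"
  proof (rule last_diminisher[of "{1..n}"])
    show "real (card B) * v i \<le> F i 1 - F i x" if "i \<in> B" for i
      using that B(1) t ends(2)[of i] card_B by (auto simp: v_def B_def)
  qed (use sm cont B vpos in auto)
  then obtain ks where ks: "distinct ks" "set ks = B"
    "splits (\<lambda>i x y. v i \<le> F i y - F i x) ks x 1" by blast
  define l where "l = js @ ks"
  have l: "distinct l" "set l = {1..n}"
    using js ks A(1) by (auto simp: l_def B_def)
  have "splits (\<lambda>i x y. v i \<le> F i y - F i x) l 0 1"
    using js(3) ks(3) by (auto simp: l_def splits_append)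
  then have "splits (\<lambda>i x y. 1 / n < F i y - F i x) l 0 1"
    using share_surplus[of "{1..n}" F v l 0 1 "1 / n" s] sm cont vge s(1) vs l by auto
  \<comment> \<open>A piece of positive value has positive length, which
    \<open>splits_pieces\<close> demands.\<close>
  then have "splits (\<lambda>i x y. 1 / n < F i y - F i x \<and> x < y) l 0 1"
  proof (rule splits_mono)
    fix i x y assume "i \<in> set l" and *: "1 / n < F i y - F i x"
    have "0 < F i y - F i x" using * by (rule le_less_trans[rotated]) simp
    then show "1 / n < F i y - F i x \<and> x < y"
      using * sm[of i] \<open>i \<in> set l\<close> l by (auto simp: strict_mono_less)
  qed
  then obtain L R where LR0:
    "\<forall>i\<in>{1..n}. 0 \<le> L i \<and> R i \<le> 1 \<and> 1 / n < F i (R i) - F i (L i) \<and> L i < R i"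
    "l \<noteq> [] \<longrightarrow> (\<Union>i\<in>{1..n}. {L i..R i}) = cake"
    "\<forall>i\<in>{1..n}. \<forall>j\<in>{1..n}. i \<noteq> j \<longrightarrow> R i \<le> L j \<or> R j \<le> L i"
    using splits_pieces[of "\<lambda>i x y. 1 / n < F i y - F i x \<and> x < y" l 0 1] l
    by (simp only: l(2)) blast
  note LR = LR0(1)[rule_format] LR0(2) LR0(3)[rule_format]
  define X where "X i = {L i..R i}" for i
  have "l \<noteq> []" using l(2) t by auto
  have fr: "frontier (X i) = {L i, R i}" if "i \<in> {1..n}" for i
    using LR(1)[OF that] by (auto simp: X_def frontier_def)
  have disj: "X i \<inter> X j \<subseteq> frontier (X i) \<inter> frontier (X j)"
    if "i \<in> {1..n}" "j \<in> {1..n}" "i \<noteq> j" for i j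
    using LR(3)[OF that] fr[OF that(1)] fr[OF that(2)] by (auto simp: X_def)
  have closed: "finite_union_of_closed_intervals (X i)" if "i \<in> {1..n}" for i
    unfolding finite_union_of_closed_intervals_def
    using LR(1)[OF that] by (intro exI[of _ "{X i}"]) (auto simp: X_def intro: less_imp_le)
  have union: "(\<Union>i\<in>{1..n}. X i) = cake"
    using LR(2) \<open>l \<noteq> []\<close> by (simp add: X_def)
  have "connected_allocation n X"
    unfolding connected_allocation_def allocation_def
    using disj closed union by (auto simp: X_def is_interval_cc)
  moreover have "strongly_proportional n V (equal_entitlements n) X"
    unfolding strongly_proportional_def equal_entitlements_def
  proof
    fix i assume i: "i \<in> {1..n}"
    show "1 / real n < V i (X i)"
      using LR(1)[OF i] valuation_atLeastAtMost[OF val[OF i], of "L i" "R i"]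
      by (simp add: X_def F_def)
  qed
  ultimately show ?thesis by blast
qed

text \<open>Here \<open>z t\<close> is the \<open>t\<close>-th mark, common to all agents. Every
  piece has one of these marks in its interior, and distinct pieces need distinct marks.\<close>

lemma not_strongly_proportional_if_marks_agree:
  fixes n :: nat and V :: "nat \<Rightarrow> real set \<Rightarrow> real"
  assumes "n \<ge> 1"
    and val: "\<And>i. i \<in> {1..n} \<Longrightarrow> valuation (V i)"
    and hun: "\<And>i. i \<in> {1..n} \<Longrightarrow> hungry (V i)"
    and z: "\<And>i t. i \<in> {1..n} \<Longrightarrow> t \<in> {1..<n} \<Longrightarrow> cdf (V i) (z t) = real t / n"
    and conn: "connected_allocation n X"
  shows "\<not> strongly_proportional n V (equal_entitlements n) X"
proof
  assume sp: "strongly_proportional n V (equal_entitlements n) X"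
  have "\<exists>t\<in>{1..<n}. z t \<in> interior (X i)" if i: "i \<in> {1..n}" for i
  proof -
    have big: "1 / n < V i (X i)"
      using sp i by (simp add: strongly_proportional_def equal_entitlements_def)
    have "0 \<le> 1 / real n" by simp
    then have "X i \<noteq> {}" using big valuation_empty[OF val[OF i]] by (metis not_less)
    have "finite_union_of_closed_intervals (X i)" "is_interval (X i)" "X i \<subseteq> cake"
      using conn i by (auto simp: connected_allocation_def allocation_def)
    \<comment> \<open>Compactness rules out half-open intervals, so the piece has the form
      \<open>{a..b}\<close>.\<close>
    then have "compact (X i)"
      unfolding finite_union_of_closed_intervals_def by (metis compact_Icc compact_Union)
    then obtain a b where ab: "X i = {a..b}"
      using \<open>is_interval (X i)\<close> is_interval_compact[of "X i"] by auto
    then have "a \<le> b" "0 \<le> a" "b \<le> 1" using \<open>X i \<noteq> {}\<close> \<open>X i \<subseteq> cake\<close> by auto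
    let ?F = "cdf (V i)"
    have sm: "strict_mono ?F" using strict_mono_cdf[OF val hun] i by simp
    have "1 / n < ?F b - ?F a"
      using big valuation_atLeastAtMost[OF val[OF i] \<open>0 \<le> a\<close> \<open>a \<le> b\<close> \<open>b \<le> 1\<close>] ab by simp
    then have gap: "n * ?F a + 1 < n * ?F b"
      using \<open>n \<ge> 1\<close> by (simp add: field_simps)
    have "0 \<le> ?F a" "?F b \<le> 1"
      using sm \<open>0 \<le> a\<close> \<open>b \<le> 1\<close> cdf_nonpos[OF val[OF i], of 0] cdf_ge_1[OF val[OF i], of 1]
        strict_mono_less_eq[OF sm, of 0 a] strict_mono_less_eq[OF sm, of b 1] by auto
    \<comment> \<open>The least integer above \<open>n * ?F a\<close>. As \<open>n * ?F\<close>
      grows by more than 1 over the piece, \<open>t\<close> lies strictly below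
      \<open>n * ?F b\<close>, hence below \<open>n\<close>.\<close>
    define t where "t = Suc (nat \<lfloor>n * ?F a\<rfloor>)"
    have "0 \<le> n * ?F a" using \<open>0 \<le> ?F a\<close> by simp
    then have "real (nat \<lfloor>n * ?F a\<rfloor>) = of_int \<lfloor>n * ?F a\<rfloor>" by simp
    then have t: "n * ?F a < real t" "real t \<le> n * ?F a + 1"
      unfolding t_def by linarith+
    have "n * ?F b \<le> n" using \<open>?F b \<le> 1\<close> by (simp add: mult_left_le)
    then have "t \<in> {1..<n}" using t gap by (simp add: t_def)
    moreover have "real n * ?F (z t) = real t"
      using z[OF i \<open>t \<in> {1..<n}\<close>] \<open>n \<ge> 1\<close> by simp
    then have "real n * ?F a < real n * ?F (z t)" "real n * ?F (z t) < real n * ?F b"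
      using t gap by linarith+
    then have "?F a < ?F (z t)" "?F (z t) < ?F b"
      using \<open>n \<ge> 1\<close> by simp_all
    then have "a < z t" "z t < b"
      using sm by (simp_all add: strict_mono_less)
    ultimately show ?thesis using ab by auto
  qed
  then obtain f where f: "\<And>i. i \<in> {1..n} \<Longrightarrow> f i \<in> {1..<n} \<and> z (f i) \<in> interior (X i)"
    by metis
  \<comment> \<open>A mark shared by two pieces would lie in their overlap, hence on the frontier of
    \<open>X i\<close>, although it is interior to \<open>X i\<close>.\<close>
  have "inj_on f {1..n}"
  proof (rule inj_onI, rule ccontr)
    fix i j assume ij: "i \<in> {1..n}" "j \<in> {1..n}" "f i = f j" "i \<noteq> j"
    then have "z (f i) \<in> X i \<inter> X j" "z (f i) \<in> interior (X i)"
      using f[of i] f[of j] interior_subset by auto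
    moreover have "X i \<inter> X j \<subseteq> frontier (X i)"
      using conn ij by (auto simp: connected_allocation_def allocation_def)
    ultimately show False by (auto simp: frontier_def)
  qed
  then have "card {1..n} \<le> card {1..<n}"
    using f by (intro card_inj_on_le[of f]) auto
  then show False using \<open>n \<ge> 1\<close> by simp
qed

theorem theorem2:
  fixes n :: nat and V :: "nat \<Rightarrow> real set \<Rightarrow> real"
  assumes "n \<ge> 1"
    and "\<And>i. i \<in> {1..n} \<Longrightarrow> valuation (V i)"
    and "\<And>i. i \<in> {1..n} \<Longrightarrow> hungry (V i)"
  shows "(result V (existence_protocol n) \<longleftrightarrow>
            (\<exists>X. connected_allocation n X \<and> strongly_proportional n V (equal_entitlements n) X))
         \<and> query_count V (existence_protocol n) \<le> n * (n - 1)"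
proof
  let ?ans = "\<lambda>i t. answer V (Mark i 0 (real t / real n))"
  have "\<exists>m. cdf (V i) m = real t / n \<and> ?ans i t = ereal m" if "i \<in> {1..n}" "t \<in> {1..<n}" for i t
    using that assms(2,3) by (intro answer_Mark_0) auto
  \<comment> \<open>All answers are finite, so the comparisons made by the protocol are comparisons
    of the real marks \<open>m i t\<close>.\<close>
  then obtain m where m: "\<And>i t. i \<in> {1..n} \<Longrightarrow> t \<in> {1..<n} \<Longrightarrow>
      cdf (V i) (m i t) = real t / n \<and> ?ans i t = ereal (m i t)"
    by metis
  have "?ans i t \<noteq> ?ans 1 t \<longleftrightarrow> m i t \<noteq> m 1 t" if "i \<in> {2..n}" "t \<in> {1..<n}" for i t
    using m[of i t] m[of 1 t] that by (simp del: answer.simps)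
  then have res: "result V (existence_protocol n) \<longleftrightarrow>
      (\<exists>t\<in>{1..<n}. \<exists>i\<in>{2..n}. m i t \<noteq> m 1 t)"
    unfolding existence_protocol_def result_scan_marks set_upt by blast
  show "result V (existence_protocol n) \<longleftrightarrow>
      (\<exists>X. connected_allocation n X \<and> strongly_proportional n V (equal_entitlements n) X)"
  proof (cases "result V (existence_protocol n)")
    case True
    then obtain t i where "t \<in> {1..<n}" "i \<in> {2..n}" "m i t \<noteq> m 1 t"
      using res by blast
    then have "\<exists>X. connected_allocation n X \<and> strongly_proportional n V (equal_entitlements n) X"
      using assms m
      by (intro strongly_proportional_if_marks_differ[where t = t and m = "\<lambda>i. m i t" and p = i and q = 1])
        auto
    then show ?thesis using True by blast
  next
    case False
    \<comment> \<open>The protocol compares agents \<open>2\<close> to \<open>n\<close> with agent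
      1, whose marks therefore serve as the common ones.\<close>
    have agree: "m i t = m 1 t" if "i \<in> {1..n}" "t \<in> {1..<n}" for i t
      using False that unfolding res by (cases "i = 1") auto
    have "cdf (V i) (m 1 t) = real t / n" if "i \<in> {1..n}" "t \<in> {1..<n}" for i t
      using m[OF that] agree[OF that] by simp
    then show ?thesis
      using False not_strongly_proportional_if_marks_agree[of n V "m 1"] assms by blast
  qed
  show "query_count V (existence_protocol n) \<le> n * (n - 1)"
    using query_count_scan_marks[OF \<open>n \<ge> 1\<close>, of V "[1..<n]"] by (simp add: existence_protocol_def)
qed

end
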